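(* Let $\mathcal C:=\mathcal X_1\times\Theta$, and suppose: (i) $\mathcal C$ is nonempty and convex, with finite affine dimension $p=\operatorname{affdim}(\mathcal C)$; (ii) the objective $c^\top x_1+\phi_0(\theta)$ is convex on $\mathcal C$ and the full master problem has a finite optimal value; (iii) for every $s\in\mathcal S$ and $\ell\in[L]$ the set $\mathcal C_{s,\ell}=\{(x_1,\theta)\in\mathcal C:\phi_\ell(\theta,\xi)\ge d(\xi,x_1)^\top s,\ \forall\xi\in\Xi\}$ is convex. Suppose further that in Algorithm EPG-O (defined in the context) every relaxed master problem and every compression test is solved exactly, that the exact separator returns a maximizing extreme point, and that $\varepsilon_{\mathrm{obj}}=0$. Then Algorithm EPG-O terminates after finitely many iterations, its output $(x_1^{(t)},\theta^{(t)})$ is optimal for the full master problem, and its output set satisfies $|\mathcal S_{\mathrm{obj}}|\le p$.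
   Context: Setting. $\Xi\subseteq\mathbb R^{N_\xi}$ is a compact uncertainty set, $C\in\mathbb R^{M\times N_2}$ with $M\ge N_2$, $b\in\mathbb R^{N_2}$, and $B,W,w,A,a,c$ are fixed data of compatible dimensions; $x_1\in\mathbb R^{N_1}$. Put $d(\xi,x_1)=W\xi+w-Bx_1\in\mathbb R^M$. The dual polyhedron $\mathcal Z=\{z\in\mathbb R^M\mid C^\top z=b,\ z\ge 0\}$ is assumed nonempty; $\mathcal S$ is its finite set of extreme points (also called vertices), and $\mathcal R$ is the finite set of extreme rays of its recession cone $\{r\mid C^\top r=0,\ r\ge0\}$. The first-stage feasible region is $$\mathcal X_1=\{x_1: Ax_1\ge a,\ \sup_{\xi\in\Xi}d(\xi,x_1)^\top r\le 0\ \ \forall r\in\mathcal R\}.$$ $\Theta\subseteq\mathbb R^{N_\theta}$, $\phi_0:\Theta\to\mathbb R$ and $\phi_\ell:\Theta\times\Xi\to\mathbb R$ ($\ell\in[L]$) are given. The full master problem is $$\min_{x_1,\theta}\ c^\top x_1+\phi_0(\theta)\quad\text{s.t.}\quad \phi_\ell(\theta,\xi)\ge d(\xi,x_1)^\top s\ \ \forall\xi\in\Xi,\ s\in\mathcal S,\ \ell\in[L],\quad x_1\in\mathcal X_1,\ \theta\in\Theta.$$ It is assumed throughout to have a finite optimal value and to attain it. Relaxed master problem (RMP) for $\mathcal S_t\subseteq\mathcal S$: $$\min_{x_1\in\mathcal X_1,\ \theta\in\Theta}\ c^\top x_1+\phi_0(\theta)\quad\text{s.t.}\quad \sup_{\xi\in\Xi}\{d(\xi,x_1)^\top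 s-\phi_\ell(\theta,\xi)\}\le 0\ \ \forall s\in\mathcal S_t,\ \ell\in[L].$$ Exact separation problem at an RMP solution $(x_1^{(t)},\theta^{(t)})$: $$V^{(t)}=\max_{\ell\in[L]}\ \max_{\xi\in\Xi,\ z\in\mathcal Z}\big[d(\xi,x_1^{(t)})^\top z-\phi_\ell(\theta^{(t)},\xi)\big].$$ Approximate separation problem: with $\Xi^{(t)}\subseteq\Xi$ a finite set of candidate worst-case scenarios obtained from the current RMP, $$V'^{(t)}=\max_{z\in\mathcal Z}\max_{\ell\in[L]}\max_{\xi\in\Xi^{(t)}}\{d(\xi,x_1^{(t)})^\top z-\phi_\ell(\theta^{(t)},\xi)\},$$ which is solved to return a maximizing vertex of $\mathcal Z$. Algorithm EPG-O. Input: a nonempty seed $\mathcal S_1\subseteq\mathcal S$ and tolerances $\varepsilon_{\mathrm{disc}},\varepsilon_{\mathrm{obj}}\ge0$. Set $t=1$ and repeat: 1. Solve the RMP for $\mathcal S_t$, obtaining an optimal $(x_1^{(t)},\theta^{(t)})$. 2. Solve the approximate separation problem, obtaining $V'^{(t)}$ and a maximizing vertex $\hat s^{(t)}\in\mathcal S$. 3. If $V'^{(t)}>\varepsilon_{\mathrm{disc}}$, set $s^\star=\hat s^{(t)}$. Otherwise, solve the exact separation problem, obtaining $V^{(t)}$ and a maximizing vertex $s^\star\in\mathcal S$; if $V^{(t)}\le\varepsilon_{\mathrm{obj}}$, compress $\mathcal S_t$ to $\mathcal S_{\mathrm{obj}}$ by deleting vertices until no further deletion preserves the RMP optimal value, return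 $(x_1^{(t)},\theta^{(t)},\mathcal S_{\mathrm{obj}})$, and stop. 4. Set $\mathcal S_{t+1}=\mathcal S_t\cup\{s^\star\}$ and $t\leftarrow t+1$. *)

theory Defs
  imports "HOL-Analysis.Analysis"
begin

record ('q::finite, 'm::finite, 'n::finite, 'k::finite, 'r::finite, 'h::finite, 'l::finite) problem =
  Xi :: "(real^'q) set"
  Cmat :: "real^'k^'m"
  bvec :: "real^'k"
  Wmat :: "real^'q^'m"
  wvec :: "real^'m"
  Bmat :: "real^'n^'m"
  Amat :: "real^'n^'r"
  avec :: "real^'r"
  cvec :: "real^'n"
  Theta :: "(real^'h) set"
  phi0 :: "real^'h \<Rightarrow> real"
  phi :: "'l \<Rightarrow> real^'h \<Rightarrow> real^'q \<Rightarrow> real"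

definition dvec :: "('q::finite,'m::finite,'n::finite,'k::finite,'r::finite,'h::finite,'l::finite) problem
    \<Rightarrow> real^'q \<Rightarrow> real^'n \<Rightarrow> real^'m" where
  "dvec P \<xi> x = Wmat P *v \<xi> + wvec P - Bmat P *v x"

text \<open>The order on \<open>real^'m\<close> is the componentwise one.\<close>

definition dual_poly :: "('q::finite,'m::finite,'n::finite,'k::finite,'r::finite,'h::finite,'l::finite) problem
    \<Rightarrow> (real^'m) set" where
  "dual_poly P = {z. transpose (Cmat P) *v z = bvec P \<and> 0 \<le> z}"

definition dual_vertices :: "('q::finite,'m::finite,'n::finite,'k::finite,'r::finite,'h::finite,'l::finite) problem
    \<Rightarrow> (real^'m) set" where
  "dual_vertices P = {s. s extreme_point_of dual_poly P}"

definition rec_cone :: "('q::finite,'m::finite,'n::finite,'k::finite,'r::finite,'h::finite,'l::finite) problem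
    \<Rightarrow> (real^'m) set" where
  "rec_cone P = {r. transpose (Cmat P) *v r = 0 \<and> 0 \<le> r}"

text \<open>Each extreme ray is represented by its unit generator; the constraints below are invariant
  under positive scaling of the generator, so the normalization is immaterial.\<close>

definition extreme_rays :: "('q::finite,'m::finite,'n::finite,'k::finite,'r::finite,'h::finite,'l::finite) problem
    \<Rightarrow> (real^'m) set" where
  "extreme_rays P = {r. norm r = 1 \<and> {\<alpha> *\<^sub>R r |\<alpha>. 0 \<le> \<alpha>} face_of rec_cone P}"

definition X1 :: "('q::finite,'m::finite,'n::finite,'k::finite,'r::finite,'h::finite,'l::finite) problem
    \<Rightarrow> (real^'n) set" where
  "X1 P = {x. avec P \<le> Amat P *v x \<and>
      (\<forall>r \<in> extreme_rays P. (SUP \<xi>\<in>Xi P. ereal (dvec P \<xi> x \<bullet> r)) \<le> 0)}"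

definition objective :: "('q::finite,'m::finite,'n::finite,'k::finite,'r::finite,'h::finite,'l::finite) problem
    \<Rightarrow> (real^'n) \<times> (real^'h) \<Rightarrow> real" where
  "objective P = (\<lambda>(x, \<theta>). cvec P \<bullet> x + phi0 P \<theta>)"

definition full_feasible :: "('q::finite,'m::finite,'n::finite,'k::finite,'r::finite,'h::finite,'l::finite) problem
    \<Rightarrow> ((real^'n) \<times> (real^'h)) set" where
  "full_feasible P = {(x, \<theta>). x \<in> X1 P \<and> \<theta> \<in> Theta P \<and>
      (\<forall>\<xi> \<in> Xi P. \<forall>s \<in> dual_vertices P. \<forall>l. phi P l \<theta> \<xi> \<ge> dvec P \<xi> x \<bullet> s)}"

definition full_optimal :: "('q::finite,'m::finite,'n::finite,'k::finite,'r::finite,'h::finite,'l::finite) problem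
    \<Rightarrow> (real^'n) \<times> (real^'h) \<Rightarrow> bool" where
  "full_optimal P = is_arg_min (objective P) (\<lambda>u. u \<in> full_feasible P)"

definition full_value :: "('q::finite,'m::finite,'n::finite,'k::finite,'r::finite,'h::finite,'l::finite) problem
    \<Rightarrow> ereal" where
  "full_value P = (INF u \<in> full_feasible P. ereal (objective P u))"

text \<open>\<open>C_sub P s l\<close> is the part of \<open>X1 P \<times> Theta P\<close> cut out by the constraints of the
  vertex \<open>s\<close> and the index \<open>l\<close>.\<close>

definition C_sub :: "('q::finite,'m::finite,'n::finite,'k::finite,'r::finite,'h::finite,'l::finite) problem
    \<Rightarrow> real^'m \<Rightarrow> 'l \<Rightarrow> ((real^'n) \<times> (real^'h)) set" where
  "C_sub P s l = {(x, \<theta>) \<in> X1 P \<times> Theta P. \<forall>\<xi> \<in> Xi P. phi P l \<theta> \<xi> \<ge> dvec P \<xi> x \<bullet> s}"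

definition rmp_feasible :: "('q::finite,'m::finite,'n::finite,'k::finite,'r::finite,'h::finite,'l::finite) problem
    \<Rightarrow> (real^'m) set \<Rightarrow> ((real^'n) \<times> (real^'h)) set" where
  "rmp_feasible P S = {(x, \<theta>). x \<in> X1 P \<and> \<theta> \<in> Theta P \<and>
      (\<forall>s \<in> S. \<forall>l. (SUP \<xi>\<in>Xi P. ereal (dvec P \<xi> x \<bullet> s - phi P l \<theta> \<xi>)) \<le> 0)}"

definition rmp_optimal :: "('q::finite,'m::finite,'n::finite,'k::finite,'r::finite,'h::finite,'l::finite) problem
    \<Rightarrow> (real^'m) set \<Rightarrow> (real^'n) \<times> (real^'h) \<Rightarrow> bool" where
  "rmp_optimal P S = is_arg_min (objective P) (\<lambda>u. u \<in> rmp_feasible P S)"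

text \<open>The value is an infimum in \<open>ereal\<close>, since deleting vertices may produce a relaxed problem
  that is unbounded below or does not attain its infimum.\<close>

definition rmp_value :: "('q::finite,'m::finite,'n::finite,'k::finite,'r::finite,'h::finite,'l::finite) problem
    \<Rightarrow> (real^'m) set \<Rightarrow> ereal" where
  "rmp_value P S = (INF u \<in> rmp_feasible P S. ereal (objective P u))"

text \<open>Separation over a scenario set \<open>X\<close>: all of \<open>Xi P\<close> for the exact problem, a finite
  candidate set for the approximate one. Maxima are taken as suprema in \<open>ereal\<close>, so they are
  meaningful without assuming attainment over \<open>X\<close>, and equal \<open>-\<infinity>\<close> if \<open>X\<close> is empty.\<close>

definition violation :: "('q::finite,'m::finite,'n::finite,'k::finite,'r::finite,'h::finite,'l::finite) problem
    \<Rightarrow> (real^'q) set \<Rightarrow> (real^'n) \<times> (real^'h) \<Rightarrow> real^'m \<Rightarrow> ereal" where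
  "violation P X = (\<lambda>(x, \<theta>) z. SUP l. SUP \<xi>\<in>X. ereal (dvec P \<xi> x \<bullet> z - phi P l \<theta> \<xi>))"

definition sep_value :: "('q::finite,'m::finite,'n::finite,'k::finite,'r::finite,'h::finite,'l::finite) problem
    \<Rightarrow> (real^'q) set \<Rightarrow> (real^'n) \<times> (real^'h) \<Rightarrow> ereal" where
  "sep_value P X u = (SUP z \<in> dual_poly P. violation P X u z)"

definition maximizing_vertex :: "('q::finite,'m::finite,'n::finite,'k::finite,'r::finite,'h::finite,'l::finite) problem
    \<Rightarrow> (real^'q) set \<Rightarrow> (real^'n) \<times> (real^'h) \<Rightarrow> real^'m \<Rightarrow> bool" where
  "maximizing_vertex P X u s \<longleftrightarrow> s \<in> dual_vertices P \<and> violation P X u s = sep_value P X u"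

text \<open>The answers returned by the subproblem solvers during one execution, indexed by the iteration
  at which they are queried. They are arbitrary here; their exactness is a property of the
  execution (\<open>solved_exactly\<close> below). \<open>keeps_value S s\<close> is the answer of the compression test
  that asks whether deleting \<open>s\<close> from \<open>S\<close> preserves the optimal value.\<close>

record ('q::finite, 'm::finite, 'n::finite, 'h::finite) answers =
  master :: "nat \<Rightarrow> (real^'n) \<times> (real^'h)"
  scenarios :: "nat \<Rightarrow> (real^'q) set"
  approx_val :: "nat \<Rightarrow> ereal"
  approx_vertex :: "nat \<Rightarrow> real^'m"
  exact_val :: "nat \<Rightarrow> ereal"
  exact_vertex :: "nat \<Rightarrow> real^'m"
  keeps_value :: "(real^'m) set \<Rightarrow> real^'m \<Rightarrow> bool"

text \<open>\<open>Iterate t S\<close>: start of iteration \<open>t\<close> with vertex set \<open>S\<close>; \<open>Compress u S\<close>: the stopping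
  test has been passed with master solution \<open>u\<close>, and \<open>S\<close> is what is left after the deletions
  made so far; \<open>Return u S\<close>: the algorithm has stopped with this output.\<close>

datatype ('m, 'n, 'h) state =
    Iterate nat "(real^'m) set"
  | Compress "(real^'n) \<times> (real^'h)" "(real^'m) set"
  | Return "(real^'n) \<times> (real^'h)" "(real^'m) set"

inductive step :: "real \<Rightarrow> real \<Rightarrow> ('q::finite,'m::finite,'n::finite,'h::finite) answers
    \<Rightarrow> ('m,'n,'h) state \<Rightarrow> ('m,'n,'h) state \<Rightarrow> bool"
  for \<epsilon>disc \<epsilon>obj :: real and Q :: "('q::finite,'m::finite,'n::finite,'h::finite) answers"
where
  add_approx: "approx_val Q t > ereal \<epsilon>disc \<Longrightarrow>
    step \<epsilon>disc \<epsilon>obj Q (Iterate t S) (Iterate (t + 1) (S \<union> {approx_vertex Q t}))"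
| add_exact: "approx_val Q t \<le> ereal \<epsilon>disc \<Longrightarrow> exact_val Q t > ereal \<epsilon>obj \<Longrightarrow>
    step \<epsilon>disc \<epsilon>obj Q (Iterate t S) (Iterate (t + 1) (S \<union> {exact_vertex Q t}))"
| stop: "approx_val Q t \<le> ereal \<epsilon>disc \<Longrightarrow> exact_val Q t \<le> ereal \<epsilon>obj \<Longrightarrow>
    step \<epsilon>disc \<epsilon>obj Q (Iterate t S) (Compress (master Q t) S)"
| delete: "s \<in> S \<Longrightarrow> keeps_value Q S s \<Longrightarrow>
    step \<epsilon>disc \<epsilon>obj Q (Compress u S) (Compress u (S - {s}))"
| finish: "\<forall>s \<in> S. \<not> keeps_value Q S s \<Longrightarrow>
    step \<epsilon>disc \<epsilon>obj Q (Compress u S) (Return u S)"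

abbreviation reachable :: "real \<Rightarrow> real \<Rightarrow> ('q::finite,'m::finite,'n::finite,'h::finite) answers
    \<Rightarrow> (real^'m) set \<Rightarrow> ('m,'n,'h) state \<Rightarrow> bool" where
  "reachable \<epsilon>disc \<epsilon>obj Q S1 \<equiv> (step \<epsilon>disc \<epsilon>obj Q)\<^sup>*\<^sup>* (Iterate 1 S1)"

text \<open>Only queries that the execution actually makes have to be answered exactly; in particular the
  exact separator is consulted only if the approximate value does not exceed \<open>\<epsilon>disc\<close>.\<close>

definition solved_exactly :: "('q::finite,'m::finite,'n::finite,'k::finite,'r::finite,'h::finite,'l::finite) problem
    \<Rightarrow> real \<Rightarrow> real \<Rightarrow> ('q,'m,'n,'h) answers \<Rightarrow> (real^'m) set \<Rightarrow> bool" where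
  "solved_exactly P \<epsilon>disc \<epsilon>obj Q S1 \<longleftrightarrow>
    (\<forall>t S. reachable \<epsilon>disc \<epsilon>obj Q S1 (Iterate t S) \<longrightarrow>
        rmp_optimal P S (master Q t) \<and>
        finite (scenarios Q t) \<and> scenarios Q t \<subseteq> Xi P \<and>
        approx_val Q t = sep_value P (scenarios Q t) (master Q t) \<and>
        maximizing_vertex P (scenarios Q t) (master Q t) (approx_vertex Q t) \<and>
        (approx_val Q t \<le> ereal \<epsilon>disc \<longrightarrow>
           exact_val Q t = sep_value P (Xi P) (master Q t) \<and>
           maximizing_vertex P (Xi P) (master Q t) (exact_vertex Q t))) \<and>
    (\<forall>u S. reachable \<epsilon>disc \<epsilon>obj Q S1 (Compress u S) \<longrightarrow>
        (\<forall>s \<in> S. keeps_value Q S s \<longleftrightarrow> rmp_value P (S - {s}) = rmp_value P S))"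

end

theory Submission
  imports Defs
begin

text \<open>
  Every vertex that the algorithm adds is violated by the current master solution, which satisfies
  the constraints of all vertices collected so far. It is therefore a new vertex, and since a
  polyhedron has only finitely many vertices (\<open>finite_dual_vertices\<close>), the growth phase ends; the
  compression phase ends because it only deletes. \<open>potential_decreases\<close> combines both phases in one
  natural-number potential.

  With \<open>\<epsilon>obj = 0\<close>, passing the stopping test means that the master solution violates no vertex
  constraint at all. An optimal point of a relaxation that is feasible for the full problem is
  optimal for it (\<open>full_optimal_if_no_violation\<close>), and compression keeps the optimal value \<open>v\<close>.

  For the cardinality bound, consider the convex set \<open>K s\<close> cut out of \<open>X1 P \<times> Theta P\<close> by the
  constraints of a vertex \<open>s\<close> in the output, together with the convex set \<open>K0\<close> of points of
  objective value below \<open>v\<close>. All these sets together have empty intersection, because \<open>v\<close> is the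
  optimal value of the relaxation. Omitting \<open>K0\<close> leaves the optimal point in common, and omitting a
  single \<open>K s\<close> leaves a common point because deleting \<open>s\<close> lowers the value. By Helly's theorem a
  family of convex sets that is minimal with empty intersection has at most \<open>p + 1\<close> members in an
  affine space of dimension \<open>p\<close> (\<open>helly_critical_family\<close>), and one member of this family is \<open>K0\<close>.
\<close>

section \<open>Critical families of convex sets\<close>

text \<open>This is Helly's theorem in contrapositive form. It is stated with the affine dimension of a
  convex ground set \<open>C\<close> instead of the dimension of the space, and for indexed families.

  A point \<open>x i\<close> common to all members but the \<open>i\<close>-th exists for each \<open>i\<close>, and distinct indices
  give distinct points, since a point chosen for two indices would lie in every member. If there
  were more than \<open>aff_dim C + 1\<close> of these points, they would be affinely dependent, and Radon's
  theorem would split them into two groups with intersecting convex hulls. A point in both hulls belongs to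
  every member: \<open>K j\<close> contains all points of the group to which \<open>x j\<close> does not belong.\<close>

lemma helly_critical_family:
  fixes K :: "'i \<Rightarrow> 'a::euclidean_space set"
  assumes fin: "finite I"
    and cK: "\<And>i. i \<in> I \<Longrightarrow> convex (K i)"
    and cC: "convex C"
    and crit: "\<And>i. i \<in> I \<Longrightarrow> C \<inter> (\<Inter>j\<in>I - {i}. K j) \<noteq> {}"
    and empty: "C \<inter> (\<Inter>j\<in>I. K j) = {}"
  shows "int (card I) \<le> aff_dim C + 1"
proof -
  have "\<forall>i\<in>I. \<exists>y. y \<in> C \<inter> (\<Inter>j\<in>I - {i}. K j)"
    using crit by (metis ex_in_conv)
  then obtain x where x: "\<forall>i\<in>I. x i \<in> C \<inter> (\<Inter>j\<in>I - {i}. K j)"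
    by (rule bchoice[THEN exE])
  have xC: "x i \<in> C" if "i \<in> I" for i
    using bspec[OF x that] by simp
  have xK: "x i \<in> K j" if "i \<in> I" "j \<in> I" "j \<noteq> i" for i j
    using bspec[OF x that(1)] that(2,3) by simp
  have inj: "inj_on x I"
  proof (rule inj_onI, rule ccontr)
    fix i j assume ij: "i \<in> I" "j \<in> I" "x i = x j" "i \<noteq> j"
    have "x i \<in> K k" if "k \<in> I" for k
      using xK[of i k] xK[of j k] ij that by (cases "k = i") simp_all
    then have "x i \<in> C \<inter> (\<Inter>j\<in>I. K j)" using xC[OF ij(1)] by simp
    with empty show False by simp
  qed
  have "\<not> affine_dependent (x ` I)"
  proof
    assume "affine_dependent (x ` I)"
    then obtain M N where MN: "M \<inter> N = {}" "M \<union> N = x ` I"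
        "convex hull M \<inter> convex hull N \<noteq> {}"
      using Radon_partition[OF finite_imageI[OF fin]] by metis
    then obtain z where zM: "z \<in> convex hull M" and zN: "z \<in> convex hull N" by blast
    have "x ` I \<subseteq> C" using xC by (rule image_subsetI)
    with MN(2) have "M \<subseteq> C" by (metis Un_upper1 subset_trans)
    then have "convex hull M \<subseteq> C" using cC by (rule hull_minimal)
    with zM have "z \<in> C" by blast
    moreover have "z \<in> K j" if j: "j \<in> I" for j
    proof -
      have avoid: "convex hull T \<subseteq> K j" if T: "T \<subseteq> x ` I" "x j \<notin> T" for T
      proof (rule hull_minimal)
        show "T \<subseteq> K j"
        proof
          fix y assume y: "y \<in> T"
          with T obtain i where "i \<in> I" "y = x i" by blast
          moreover from this y T(2) have "j \<noteq> i" by blast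
          ultimately show "y \<in> K j" using xK j by simp
        qed
      qed (rule cK[OF j])
      have "x j \<notin> M \<or> x j \<notin> N" using MN(1) by blast
      then show ?thesis
        using avoid[of M] avoid[of N] MN(2) zM zN by (metis Un_upper1 Un_upper2 subsetD)
    qed
    ultimately have "z \<in> C \<inter> (\<Inter>j\<in>I. K j)" by simp
    with empty show False by simp
  qed
  then have "int (card (x ` I)) \<le> aff_dim C + 1"
    using xC by (intro independent_card_le_aff_dim) auto
  then show ?thesis by (simp add: card_image inj)
qed

lemma convex_strict_sublevel:
  fixes f :: "'a::real_vector \<Rightarrow> real"
  assumes "convex_on C f"
  shows "convex {x \<in> C. f x < v}"
proof (rule convexI)
  fix x y :: 'a and a b :: real
  assume xy: "x \<in> {x \<in> C. f x < v}" "y \<in> {x \<in> C. f x < v}" and ab: "0 \<le> a" "0 \<le> b" "a + b = 1"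
  have "a *\<^sub>R x + b *\<^sub>R y \<in> C"
    using xy ab by (intro convexD[OF convex_on_imp_convex[OF assms]]) simp_all
  moreover have "f (a *\<^sub>R x + b *\<^sub>R y) \<le> a * f x + b * f y"
    using assms xy ab unfolding convex_on_def by simp
  moreover have "a * f x + b * f y < v"
    using xy ab by (intro convex_bound_lt) simp_all
  ultimately show "a *\<^sub>R x + b *\<^sub>R y \<in> {x \<in> C. f x < v}" by simp
qed

section \<open>The relaxed problems\<close>

lemma finite_dual_vertices: "finite (dual_vertices P)"
proof -
  have orthant: "{z. 0 \<le> z} = (\<Inter>i. {z::real^'m. axis i 1 \<bullet> z \<ge> 0})"
    by (auto simp: less_eq_vec_def inner_axis')
  have "polyhedron {z::real^'m. 0 \<le> z}"
    unfolding orthant by (intro polyhedron_Inter) (auto intro: polyhedron_halfspace_ge)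
  moreover have "affine {z. transpose (Cmat P) *v z = bvec P}"
    unfolding affine_def
    by (auto simp: matrix_vector_right_distrib matrix_vector_mult_scaleR
        simp del: transpose_matrix_vector simp flip: scaleR_left_distrib)
  ultimately have "polyhedron (dual_poly P)"
    unfolding dual_poly_def Collect_conj_eq
    using affine_imp_polyhedron polyhedron_Int by blast
  then show ?thesis
    unfolding dual_vertices_def by (rule finite_polyhedron_extreme_points)
qed

lemma rmp_feasible_eq:
  "rmp_feasible P S = (X1 P \<times> Theta P) \<inter> (\<Inter>s\<in>S. \<Inter>l. C_sub P s l)"
  by (auto simp: rmp_feasible_def C_sub_def SUP_le_iff)

lemma full_feasible_eq: "full_feasible P = rmp_feasible P (dual_vertices P)"
  by (auto simp: rmp_feasible_def full_feasible_def SUP_le_iff)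

lemma rmp_feasible_antimono: "S \<subseteq> T \<Longrightarrow> rmp_feasible P T \<subseteq> rmp_feasible P S"
  unfolding rmp_feasible_eq by blast

lemma violation_le_0_iff:
  assumes "u \<in> X1 P \<times> Theta P"
  shows "violation P (Xi P) u s \<le> 0 \<longleftrightarrow> u \<in> rmp_feasible P {s}"
  using assms by (auto simp: violation_def rmp_feasible_def SUP_le_iff)

lemma violation_mono: "X \<subseteq> Y \<Longrightarrow> violation P X u s \<le> violation P Y u s"
  unfolding violation_def
  by (cases u, simp only: prod.case) (rule SUP_mono', rule SUP_subset_mono; simp)

lemma rmp_value_eq_if_optimal:
  assumes "rmp_optimal P S u"
  shows "rmp_value P S = ereal (objective P u)"
  unfolding rmp_value_def
  using assms by (intro antisym INF_lower INF_greatest)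
    (auto simp: rmp_optimal_def is_arg_min_def not_less)

lemma full_optimal_if_no_violation:
  assumes S: "S \<subseteq> dual_vertices P" and opt: "rmp_optimal P S u"
    and sep: "sep_value P (Xi P) u \<le> 0"
  shows "full_optimal P u"
proof -
  have u: "u \<in> rmp_feasible P S" using opt by (simp add: rmp_optimal_def is_arg_min_def)
  then have uC: "u \<in> X1 P \<times> Theta P" by (simp add: rmp_feasible_eq)
  have "u \<in> rmp_feasible P {s}" if "s \<in> dual_vertices P" for s
  proof -
    have "s \<in> dual_poly P"
      using that by (simp add: dual_vertices_def extreme_point_of_def)
    then have "violation P (Xi P) u s \<le> 0"
      using sep by (simp add: sep_value_def SUP_le_iff)
    with uC show ?thesis by (simp add: violation_le_0_iff)
  qed
  then have "u \<in> full_feasible P"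
    unfolding full_feasible_eq using uC by (auto simp: rmp_feasible_eq)
  moreover have "full_feasible P \<subseteq> rmp_feasible P S"
    unfolding full_feasible_eq by (rule rmp_feasible_antimono[OF S])
  ultimately show ?thesis
    using opt by (auto simp: full_optimal_def rmp_optimal_def is_arg_min_def)
qed

text \<open>The master solution satisfies the constraints of all vertices in \<open>S\<close> for every scenario. This
  covers separation over any scenario subset \<open>X\<close>, hence the approximate and the exact separator
  alike.\<close>

lemma separating_vertex_is_new:
  assumes opt: "rmp_optimal P S u" and X: "X \<subseteq> Xi P" and mv: "maximizing_vertex P X u s"
    and pos: "sep_value P X u > 0"
  shows "s \<notin> S"
proof
  assume "s \<in> S"
  moreover have u: "u \<in> rmp_feasible P S" using opt by (simp add: rmp_optimal_def is_arg_min_def)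
  ultimately have "u \<in> rmp_feasible P {s}" using rmp_feasible_antimono[of "{s}" S P] by blast
  moreover have "u \<in> X1 P \<times> Theta P" using u by (simp add: rmp_feasible_eq)
  ultimately have "violation P (Xi P) u s \<le> 0" by (simp add: violation_le_0_iff)
  moreover have "0 < violation P X u s" using mv pos by (simp add: maximizing_vertex_def)
  ultimately show False using violation_mono[OF X, of P u s] by simp
qed

text \<open>Deleting a vertex may leave a relaxed problem that is unbounded or does not attain its infimum.
  A drop in the value still yields a feasible point strictly below the old value, and such a point
  is what makes the family in Helly's theorem critical.\<close>

lemma card_le_aff_dim_if_irredundant:
  assumes C: "convex (X1 P \<times> Theta P)"
    and obj: "convex_on (X1 P \<times> Theta P) (objective P)"
    and sub: "\<forall>s \<in> S. \<forall>l. convex (C_sub P s l)"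
    and fin: "finite S"
    and u: "u \<in> rmp_feasible P S"
    and val: "rmp_value P S = ereal (objective P u)"
    and irr: "\<forall>s \<in> S. rmp_value P (S - {s}) \<noteq> rmp_value P S"
  shows "int (card S) \<le> aff_dim (X1 P \<times> Theta P)"
proof -
  let ?C = "X1 P \<times> Theta P"
  \<comment> \<open>The index \<open>None\<close> stands for the improving points, \<open>Some s\<close> for the constraints of \<open>s\<close>.\<close>
  define K where "K = case_option {y \<in> ?C. objective P y < objective P u} (\<lambda>s. \<Inter>l. C_sub P s l)"
  define I where "I = insert None (Some ` S)"
  have feas: "?C \<inter> (\<Inter>j\<in>Some ` T. K j) = rmp_feasible P T" for T
    by (simp add: K_def rmp_feasible_eq)
  have "int (card I) \<le> aff_dim ?C + 1"
  proof (rule helly_critical_family[where K = K])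
    show "finite I" using fin by (simp add: I_def)
    show "convex ?C" by (rule C)
    show "convex (K i)" if "i \<in> I" for i
      using that sub convex_strict_sublevel[OF obj]
      by (auto simp: I_def K_def intro!: convex_INT)
    have "objective P u \<le> objective P y" if "y \<in> rmp_feasible P S" for y
    proof -
      have "rmp_value P S \<le> ereal (objective P y)"
        unfolding rmp_value_def using that by (rule INF_lower)
      with val show ?thesis by simp
    qed
    then have "rmp_feasible P S \<inter> K None = {}" by (force simp: K_def)
    then show "?C \<inter> (\<Inter>j\<in>I. K j) = {}" unfolding feas[symmetric] I_def by blast
    show "?C \<inter> (\<Inter>j\<in>I - {i}. K j) \<noteq> {}" if i: "i \<in> I" for i
    proof (cases i)
      case None
      then have "I - {i} = Some ` S" by (auto simp: I_def)
      with u show ?thesis by (auto simp only: feas)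
    next
      case (Some s)
      with i have s: "s \<in> S" by (auto simp: I_def)
      have I': "I - {i} = insert None (Some ` (S - {s}))" using Some by (auto simp: I_def)
      have "rmp_value P (S - {s}) \<le> rmp_value P S"
        unfolding rmp_value_def by (intro INF_superset_mono rmp_feasible_antimono) auto
      with irr s val have "rmp_value P (S - {s}) < ereal (objective P u)"
        by (metis order_le_less)
      then obtain y where y: "y \<in> rmp_feasible P (S - {s})" "objective P y < objective P u"
        by (auto simp: rmp_value_def INF_less_iff)
      then have "y \<in> K None" by (auto simp: K_def rmp_feasible_eq)
      with y(1) show ?thesis unfolding I' feas[symmetric] by blast
    qed
  qed
  moreover have "card I = card S + 1"
    using fin by (simp add: I_def card_image)
  ultimately show ?thesis by simp
qed

section \<open>Executions of the algorithm\<close>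

lemma solved_exactly_iterate:
  assumes "solved_exactly P \<epsilon>disc \<epsilon>obj Q S1" "reachable \<epsilon>disc \<epsilon>obj Q S1 (Iterate t S)"
  shows "rmp_optimal P S (master Q t)"
    and "scenarios Q t \<subseteq> Xi P"
    and "approx_val Q t = sep_value P (scenarios Q t) (master Q t)"
    and "maximizing_vertex P (scenarios Q t) (master Q t) (approx_vertex Q t)"
    and "approx_val Q t \<le> ereal \<epsilon>disc \<Longrightarrow> exact_val Q t = sep_value P (Xi P) (master Q t)"
    and "approx_val Q t \<le> ereal \<epsilon>disc \<Longrightarrow>
      maximizing_vertex P (Xi P) (master Q t) (exact_vertex Q t)"
  using assms(1)[unfolded solved_exactly_def, THEN conjunct1, rule_format, OF assms(2)]
  by blast+

lemma solved_exactly_compress: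
  assumes "solved_exactly P \<epsilon>disc \<epsilon>obj Q S1" "reachable \<epsilon>disc \<epsilon>obj Q S1 (Compress u S)" "s \<in> S"
  shows "keeps_value Q S s \<longleftrightarrow> rmp_value P (S - {s}) = rmp_value P S"
  using assms(1)[unfolded solved_exactly_def, THEN conjunct2, rule_format, OF assms(2,3)] .

fun invariant :: "('q::finite,'m::finite,'n::finite,'k::finite,'r::finite,'h::finite,'l::finite) problem
    \<Rightarrow> ('m,'n,'h) state \<Rightarrow> bool" where
  "invariant P (Iterate t S) \<longleftrightarrow> S \<subseteq> dual_vertices P"
| "invariant P (Compress u S) \<longleftrightarrow> S \<subseteq> dual_vertices P \<and> full_optimal P u \<and>
     rmp_value P S = ereal (objective P u)"
| "invariant P (Return u S) \<longleftrightarrow> S \<subseteq> dual_vertices P \<and> full_optimal P u \<and>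
     rmp_value P S = ereal (objective P u) \<and> (\<forall>s \<in> S. rmp_value P (S - {s}) \<noteq> rmp_value P S)"

lemma reachable_invariant:
  assumes "S1 \<subseteq> dual_vertices P" and ex: "solved_exactly P \<epsilon>disc 0 Q S1"
    and "reachable \<epsilon>disc 0 Q S1 st"
  shows "invariant P st"
  using assms(3)
proof (induction rule: rtranclp_induct)
  case base
  then show ?case using assms(1) by simp
next
  case (step st st')
  note reach = step.hyps(1) and inv = step.IH
  note iter = solved_exactly_iterate[OF ex] and compr = solved_exactly_compress[OF ex]
  from step.hyps(2) show ?case
  proof cases
    case (add_approx t S)
    have "approx_vertex Q t \<in> dual_vertices P"
      using iter(4) reach unfolding add_approx(1) maximizing_vertex_def by blast
    with inv add_approx(1,2) show ?thesis by simp
  next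
    case (add_exact t S)
    have "exact_vertex Q t \<in> dual_vertices P"
      using iter(6) reach add_exact(3) unfolding add_exact(1) maximizing_vertex_def by blast
    with inv add_exact(1,2) show ?thesis by simp
  next
    case (stop t S)
    note r = reach[unfolded stop(1)]
    have sep: "sep_value P (Xi P) (master Q t) \<le> 0"
      using iter(5)[OF r stop(3)] stop(4) by (simp add: zero_ereal_def)
    have "S \<subseteq> dual_vertices P" using inv stop(1) by simp
    with iter(1)[OF r] sep show ?thesis
      unfolding stop(2) by (simp add: full_optimal_if_no_violation rmp_value_eq_if_optimal)
  next
    case (delete s S u)
    have "rmp_value P (S - {s}) = rmp_value P S"
      using compr reach delete(3,4) unfolding delete(1) by blast
    with inv show ?thesis unfolding delete(1,2) by auto
  next
    case (finish S u)
    have "\<forall>s\<in>S. rmp_value P (S - {s}) \<noteq> rmp_value P S"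
      using compr reach finish(3) unfolding finish(1) by blast
    with inv show ?thesis unfolding finish(1,2) by simp
  qed
qed

text \<open>With \<open>n\<close> the number of dual vertices, \<open>n - card S\<close> bounds the additions still to come, and the
  offset \<open>n + 2\<close> keeps every state of the growth phase above the values \<open>card S + 1 \<le> n + 1\<close> of the
  compression phase.\<close>

fun potential :: "nat \<Rightarrow> ('m::finite,'n::finite,'h::finite) state \<Rightarrow> nat" where
  "potential n (Iterate t S) = (n - card S) + n + 2"
| "potential n (Compress u S) = card S + 1"
| "potential n (Return u S) = 0"

lemma potential_decreases:
  assumes S1: "S1 \<subseteq> dual_vertices P" and ex: "solved_exactly P \<epsilon>disc 0 Q S1" and "\<epsilon>disc \<ge> 0"
    and r: "reachable \<epsilon>disc 0 Q S1 st" and st: "step \<epsilon>disc 0 Q st st'"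
  shows "potential (card (dual_vertices P)) st' < potential (card (dual_vertices P)) st"
proof -
  note fin = finite_dual_vertices[of P]
  have inv: "invariant P st" and inv': "invariant P st'"
    using reachable_invariant[OF S1 ex] r st by (auto intro: rtranclp.rtrancl_into_rtrancl)
  have grow: "potential (card (dual_vertices P)) (Iterate (t + 1) (S \<union> {s}))
      < potential (card (dual_vertices P)) (Iterate t S)"
    if "S \<union> {s} \<subseteq> dual_vertices P" "s \<notin> S" for t S s
  proof -
    have "card (insert s S) \<le> card (dual_vertices P)"
      using card_mono[OF fin that(1)] by simp
    moreover have "card (insert s S) = Suc (card S)"
      using that finite_subset[OF _ fin, of S] by (intro card_insert_disjoint) auto
    ultimately show ?thesis by simp
  qed
  note iter = solved_exactly_iterate[OF ex]
  from st show ?thesis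
  proof cases
    case (add_approx t S)
    note r = r[unfolded add_approx(1)]
    have "0 < approx_val Q t"
      using add_approx(3) \<open>\<epsilon>disc \<ge> 0\<close> by (metis ereal_less_eq(5) order_le_less_trans)
    then have "approx_vertex Q t \<notin> S"
      using separating_vertex_is_new[OF iter(1,2,4)[OF r]] iter(3)[OF r] by simp
    with inv' show ?thesis unfolding add_approx(1,2) by (intro grow) simp_all
  next
    case (add_exact t S)
    note r = r[unfolded add_exact(1)]
    have "exact_vertex Q t \<notin> S"
      using separating_vertex_is_new[OF iter(1)[OF r] subset_refl iter(6)[OF r add_exact(3)]]
        iter(5)[OF r add_exact(3)] add_exact(4) by (simp add: zero_ereal_def)
    with inv' show ?thesis unfolding add_exact(1,2) by (intro grow) simp_all
  next
    case (stop t S)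
    with inv card_mono[OF fin, of S] show ?thesis by simp
  next
    case (delete s S u)
    have "finite S" using inv finite_subset[OF _ fin] unfolding delete(1) by simp
    with delete(3) have "card (S - {s}) < card S" by (rule card_Diff1_less[rotated])
    then show ?thesis unfolding delete(1,2) by simp
  next
    case (finish S u)
    then show ?thesis by simp
  qed
qed

lemma no_infinite_execution:
  assumes S1: "S1 \<subseteq> dual_vertices P" and ex: "solved_exactly P \<epsilon>disc 0 Q S1" and "\<epsilon>disc \<ge> 0"
  shows "\<nexists>f. f 0 = Iterate 1 S1 \<and> (\<forall>i. step \<epsilon>disc 0 Q (f i) (f (Suc i)))"
proof
  assume "\<exists>f. f 0 = Iterate 1 S1 \<and> (\<forall>i. step \<epsilon>disc 0 Q (f i) (f (Suc i)))"
  then obtain f where f0: "f 0 = Iterate 1 S1" and fS: "\<And>i. step \<epsilon>disc 0 Q (f i) (f (Suc i))"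
    by blast
  have reach: "reachable \<epsilon>disc 0 Q S1 (f i)" for i
  proof (induction i)
    case (Suc i)
    then show ?case using fS by (rule rtranclp.rtrancl_into_rtrancl)
  qed (simp add: f0)
  have "\<forall>i. (f (Suc i), f i) \<in> inv_image less_than (potential (card (dual_vertices P)))"
    using potential_decreases[OF assms reach fS] by simp
  then show False
    using wf_inv_image[OF wf_less_than] wf_iff_no_infinite_down_chain by metis
qed

lemma stuck_only_at_return:
  assumes "\<nexists>st'. step \<epsilon>disc \<epsilon>obj Q st st'"
  shows "\<exists>u S. st = Return u S"
proof (cases st)
  case (Iterate t S)
  with assms show ?thesis
    using step.intros(1,2,3)[where t = t and S = S and Q = Q] by (meson linorder_not_less)
next
  case (Compress u S)
  with assms show ?thesis
    using step.intros(4,5)[where u = u and S = S and Q = Q] by meson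
qed blast


theorem theorem2:
  fixes P :: "('q::finite,'m::finite,'n::finite,'k::finite,'r::finite,'h::finite,'l::finite) problem"
    and Q :: "('q,'m,'n,'h) answers"
    and S1 :: "(real^'m) set"
    and \<epsilon>disc \<epsilon>obj :: real
    and p :: int
  assumes "CARD('k) \<le> CARD('m)"
    and "compact (Xi P)"
    and "dual_poly P \<noteq> {}"
    and "X1 P \<times> Theta P \<noteq> {}"
    and "convex (X1 P \<times> Theta P)"
    and "p = aff_dim (X1 P \<times> Theta P)"
    and "convex_on (X1 P \<times> Theta P) (objective P)"
    and "\<bar>full_value P\<bar> \<noteq> \<infinity>"
    and "\<exists>u. full_optimal P u"
    and "\<forall>s \<in> dual_vertices P. \<forall>l. convex (C_sub P s l)"
    and "S1 \<noteq> {}" and "S1 \<subseteq> dual_vertices P"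
    and "\<epsilon>disc \<ge> 0" and "\<epsilon>obj = 0"
    and "solved_exactly P \<epsilon>disc \<epsilon>obj Q S1"
  shows "(\<nexists>f. f 0 = Iterate 1 S1 \<and> (\<forall>i. step \<epsilon>disc \<epsilon>obj Q (f i) (f (Suc i))))
    \<and> (\<forall>st. reachable \<epsilon>disc \<epsilon>obj Q S1 st \<and> (\<nexists>st'. step \<epsilon>disc \<epsilon>obj Q st st')
          \<longrightarrow> (\<exists>u Sobj. st = Return u Sobj))
    \<and> (\<forall>u Sobj. reachable \<epsilon>disc \<epsilon>obj Q S1 (Return u Sobj)
          \<longrightarrow> full_optimal P u \<and> finite Sobj \<and> int (card Sobj) \<le> p)"
proof (intro conjI allI impI)
  note ex = assms(15)[unfolded assms(14)]
  show "\<nexists>f. f 0 = Iterate 1 S1 \<and> (\<forall>i. step \<epsilon>disc \<epsilon>obj Q (f i) (f (Suc i)))"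
    unfolding assms(14) by (rule no_infinite_execution[OF assms(12) ex assms(13)])
  show "\<exists>u Sobj. st = Return u Sobj"
    if "reachable \<epsilon>disc \<epsilon>obj Q S1 st \<and> (\<nexists>st'. step \<epsilon>disc \<epsilon>obj Q st st')" for st
    using that stuck_only_at_return by blast
  fix u Sobj
  assume "reachable \<epsilon>disc \<epsilon>obj Q S1 (Return u Sobj)"
  then have inv: "invariant P (Return u Sobj)"
    unfolding assms(14) by (rule reachable_invariant[OF assms(12) ex])
  then show opt: "full_optimal P u" by simp
  show fin: "finite Sobj"
    using inv finite_dual_vertices by (auto intro: finite_subset)
  have "u \<in> full_feasible P"
    using opt by (simp add: full_optimal_def is_arg_min_def)
  then have "u \<in> rmp_feasible P Sobj"
    using inv rmp_feasible_antimono[of Sobj "dual_vertices P" P] by (auto simp: full_feasible_eq)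
  then have "int (card Sobj) \<le> aff_dim (X1 P \<times> Theta P)"
    using inv assms(10) fin by (intro card_le_aff_dim_if_irredundant[OF assms(5,7)]) auto
  then show "int (card Sobj) \<le> p" by (simp only: assms(6))
qed

end
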